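(* Let $n \in \mathbb{N}$ and let $A \subset \mathbb{R}$ be a convex set with $|A| = n$. Then there exists a matching $M \subset A \times A$ with $|M| \geq \lfloor n/2 \rfloor$ such that the set $A +_M A := \{a + b : (a,b) \in M\}$ is convex.
   Context: A finite set $B = \{b_1 < b_2 < \dots < b_m\} \subset \mathbb{R}$ is called convex if its consecutive differences are strictly increasing, i.e. $b_{i+1} - b_i > b_i - b_{i-1}$ for all $i = 2, \dots, m-1$. A set $M \subset A \times A$ is a matching if its elements are pairwise disjoint, i.e. no element of $A$ occurs as a coordinate of two distinct pairs of $M$. *)

theory Defs
  imports Complex_Main
begin

text \<open>
  Convexity of a finite set of reals in the additive-combinatorics sense (not convexity of a
  subset of a vector space). Indices start at 0: \<open>b ! i\<close> is the element usually written
  \<open>b\<^sub>i\<^sub>+\<^sub>1\<close>. Sets with at most two elements, including the empty set, are convex.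
\<close>

definition convex_set :: "real set \<Rightarrow> bool" where
  "convex_set B \<longleftrightarrow> finite B \<and>
     (let b = sorted_list_of_set B in
       \<forall>i. 1 \<le> i \<and> i + 1 < card B \<longrightarrow> b ! (i + 1) - b ! i > b ! i - b ! (i - 1))"

text \<open>
  The pairs are the edges of a matching in the graph-theoretic sense, so the two coordinates of a
  pair are distinct; without this clause the diagonal of \<open>A\<close> would be a matching.
\<close>

definition matching :: "'a set \<Rightarrow> ('a \<times> 'a) set \<Rightarrow> bool" where
  "matching A M \<longleftrightarrow> M \<subseteq> A \<times> A \<and> (\<forall>(a, b)\<in>M. a \<noteq> b) \<and>
     pairwise (\<lambda>(a, b) (c, d). {a, b} \<inter> {c, d} = {}) M"

text \<open>The set \<open>A +\<^sub>M A\<close>; it depends on \<open>A\<close> only through \<open>M\<close>.\<close>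

definition sumset_along :: "(real \<times> real) set \<Rightarrow> real set" where
  "sumset_along M = {a + b | a b. (a, b) \<in> M}"

end

(* Pair consecutive elements: for A = {a 0 < a 1 < ...} use the sums a (2 i) + a (2 i + 1). The
   differences of these sums are a (2 i + 2) - a (2 i) plus a (2 i + 3) - a (2 i + 1), and both
   terms increase with i because the consecutive differences of A do. *)
theory Submission
  imports Defs
begin

text \<open>Strict monotonicity makes \<open>map s [0..<m]\<close> the sorted list of the image and
  keeps its cardinality at \<open>m\<close>, so convexity can be checked on \<open>s\<close> by
  index.\<close>

lemma convex_set_image:
  fixes s :: "nat \<Rightarrow> real"
  assumes mono: "strict_mono_on {..<m} s"
    and convex: "\<And>i. i + 2 < m \<Longrightarrow> s (i + 1) - s i < s (i + 2) - s (i + 1)"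
  shows "convex_set (s ` {..<m})"
proof -
  have "sorted_wrt (<) (map s [0..<m])"
    unfolding sorted_wrt_map
    by (rule sorted_wrt_mono_rel[OF _ sorted_wrt_upt])
       (auto intro: strict_mono_onD[OF mono])
  then have list: "sorted_list_of_set (s ` {..<m}) = map s [0..<m]"
    by (intro strict_sorted_equal) (auto simp: atLeast0LessThan)
  have card: "card (s ` {..<m}) = m"
    using strict_mono_on_imp_inj_on[OF mono] by (simp add: card_image)
  have "s i - s (i - 1) < s (i + 1) - s i" if "1 \<le> i" "i + 1 < m" for i
    using convex[of "i - 1"] that by (simp add: numeral_2_eq_2)
  then show ?thesis
    unfolding convex_set_def Let_def list card by auto
qed

theorem theorem4:
  fixes n :: nat and A :: "real set"
  assumes "convex_set A" and "card A = n"
  shows "\<exists>M. matching A M \<and> int (card M) \<ge> \<lfloor>real n / 2\<rfloor> \<and> convex_set (sumset_along M)"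
proof -
  define a where "a i = sorted_list_of_set A ! i" for i
  define p where "p i = (a (2 * i), a (2 * i + 1))" for i
  \<comment> \<open>For odd \<open>n\<close> the largest element of \<open>A\<close> stays
    unpaired.\<close>
  define m where "m = n div 2"
  \<comment> \<open>The definition indexes a triple by its middle element; indexing by the first
    avoids subtraction on naturals.\<close>
  have diff: "a (i + 1) - a i < a (i + 2) - a (i + 1)" if "i + 2 < n" for i
    using assms that unfolding convex_set_def Let_def a_def
    by (auto dest!: spec[of _ "i + 1"] simp: numeral_2_eq_2)
  have fin: "finite A"
    using assms unfolding convex_set_def by simp
  have less: "a i < a j" if "i < j" "j < n" for i j
    using that assms(2) sorted_wrt_nth_less[OF strict_sorted_list_of_set, of i j A] by (simp add: a_def)
  have eq_iff: "a i = a j \<longleftrightarrow> i = j" if "i < n" "j < n" for i j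
    using less that by (metis less_irrefl linorder_neqE_nat)
  have mem: "a i \<in> A" if "i < n" for i
    using that assms(2) fin nth_mem[of i "sorted_list_of_set A"] by (simp add: a_def)
  have bounds: "2 * i < n" "2 * i + 1 < n" if "i < m" for i
    using that unfolding m_def by linarith+
  \<comment> \<open>By \<open>eq_iff\<close>, a coincidence of coordinates is one of indices; parity
    excludes a first coordinate equal to a second one, within a pair or across pairs.\<close>
  have parity: "2 * i \<noteq> 2 * j + 1" for i j :: nat
    by presburger
  have "matching A (p ` {..<m})"
    unfolding matching_def pairwise_def p_def
    using bounds mem parity by (auto simp: eq_iff simp del: One_nat_def)
  moreover have "inj_on p {..<m}"
    using bounds by (auto simp: inj_on_def p_def eq_iff)
  then have "card (p ` {..<m}) = m"
    by (simp add: card_image)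
  then have "int (card (p ` {..<m})) \<ge> \<lfloor>real n / 2\<rfloor>"
    using floor_divide_of_nat_eq[of n 2, where 'a = real] by (simp add: m_def)
  moreover have "convex_set ((\<lambda>i. a (2 * i) + a (2 * i + 1)) ` {..<m})"
  proof (rule convex_set_image)
    show "strict_mono_on {..<m} (\<lambda>i. a (2 * i) + a (2 * i + 1))"
      using bounds by (auto intro!: strict_mono_onI add_strict_mono less)
    fix i assume "i + 2 < m"
    \<comment> \<open>Three consecutive sums involve \<open>a\<close> up to index
      \<open>2 * (i + 2) + 1\<close>. With d0, ..., d4 the differences of \<open>a\<close> from
      index \<open>2 * i\<close> on, the claim is d0 + 2 d1 + d2 < d2 + 2 d3 + d4, and the four
      instances of \<open>diff\<close> give d0 < d1 < d2 < d3 < d4.\<close>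
    then have "2 * i + 5 < n"
      unfolding m_def by linarith
    then show "a (2 * (i + 1)) + a (2 * (i + 1) + 1) - (a (2 * i) + a (2 * i + 1))
        < a (2 * (i + 2)) + a (2 * (i + 2) + 1) - (a (2 * (i + 1)) + a (2 * (i + 1) + 1))"
      using diff[of "2 * i"] diff[of "2 * i + 1"] diff[of "2 * i + 2"] diff[of "2 * i + 3"]
      by (simp add: eval_nat_numeral)
  qed
  moreover have "sumset_along (p ` {..<m}) = (\<lambda>i. a (2 * i) + a (2 * i + 1)) ` {..<m}"
    unfolding sumset_along_def p_def by auto
  ultimately show ?thesis
    by auto
qed

end
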